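(* Let $X \in \mathbb{R}^{n\times p}$, $\beta^0 \in \mathbb{R}^p$, $\epsilon \in \mathbb{R}^n$ and $y = X\beta^0 + \epsilon$. Let $S^0 = \{j : \beta^0_j \neq 0\}$ and $\beta^0_{\min} := \min\{|\beta^0_j| : j \in S^0\}$. Assume $\operatorname{rank} X = n$ and that, for some $\rho \in (0,1)$, the stable null space property $$\|\beta_{S^0}\|_1 \le \rho\, \|\beta_{\overline{S^0}}\|_1 \quad \text{for all } \beta \in \ker(X)$$ holds. If $$\beta^0_{\min} > C_\rho\, \|\hat\beta^{\ell_1}(\epsilon)\|_1, \qquad C_\rho = \frac{2(3+\rho)}{1-\rho},$$ then there exists a threshold $\tau > 0$ such that $$\operatorname{sign}\big(\hat\beta^{\mathrm{lass0}(0,1)}_{\tau,j}\big) = \operatorname{sign}(\beta^0_j) \quad \text{for every } j \in \{1,\dots,p\}.$$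
   Context: For $v \in \mathbb{R}^n$, $\hat\beta^{\ell_1}(v)$ denotes the basis pursuit solution, i.e. the solution of $\min_{\beta \in \mathbb{R}^p} \|\beta\|_1$ subject to $v = X\beta$ (if the minimizer is not unique, any fixed choice of minimizer). The Lasso-Zero estimator with parameters $(q,M)=(0,1)$ and threshold $\tau \ge 0$ is $\hat\beta^{\mathrm{lass0}(0,1)}_{\tau,j} := \eta_\tau(\hat\beta^{\ell_1}_j(y))$ for $j=1,\dots,p$, where $\eta_\tau:\mathbb{R}\to\mathbb{R}$ is any thresholding function satisfying $\eta_\tau(x) = 0$ if $|x| \le \tau$ and $\operatorname{sign}(\eta_\tau(x)) = \operatorname{sign}(x)$ otherwise (for example hard or soft thresholding). Here $\operatorname{sign}(0)=0$. For a vector $\beta\in\mathbb{R}^p$ and $S \subset \{1,\dots,p\}$, $\beta_S$ is the subvector indexed by $S$, and $\overline{S}$ is the complement of $S$ in $\{1,\dots,p\}$. By convention the minimum over the empty set is $+\infty$. *)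

theory Defs
  imports "HOL-Analysis.Analysis"
begin

definition l1_on :: "'p set \<Rightarrow> real ^ 'p::finite \<Rightarrow> real" where
  "l1_on S \<beta> = (\<Sum>j\<in>S. \<bar>\<beta> $ j\<bar>)"

abbreviation l1_norm :: "real ^ 'p::finite \<Rightarrow> real" where
  "l1_norm \<equiv> l1_on UNIV"

definition basis_pursuit_solution ::
    "real ^ 'p::finite ^ 'n::finite \<Rightarrow> real ^ 'n \<Rightarrow> real ^ 'p \<Rightarrow> bool" where
  "basis_pursuit_solution X v = is_arg_min l1_norm (\<lambda>\<beta>. v = X *v \<beta>)"

text \<open>Minimizers need not be unique. An admissible \<open>bp\<close> picks one minimizer for each feasible
  right-hand side; its values at infeasible ones are unconstrained.\<close>

definition basis_pursuit_choice ::
    "real ^ 'p::finite ^ 'n::finite \<Rightarrow> (real ^ 'n \<Rightarrow> real ^ 'p) \<Rightarrow> bool" where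
  "basis_pursuit_choice X bp \<longleftrightarrow>
     (\<forall>v. (\<exists>\<beta>. v = X *v \<beta>) \<longrightarrow> basis_pursuit_solution X v (bp v))"

definition thresholding :: "real \<Rightarrow> (real \<Rightarrow> real) \<Rightarrow> bool" where
  "thresholding \<tau> f \<longleftrightarrow>
     (\<forall>x. (\<bar>x\<bar> \<le> \<tau> \<longrightarrow> f x = 0) \<and> (\<not> \<bar>x\<bar> \<le> \<tau> \<longrightarrow> sgn (f x) = sgn x))"

text \<open>The Lasso-Zero estimator for \<open>(q, M) = (0, 1)\<close>, with thresholding functions \<open>\<eta> \<tau>\<close> and
  basis pursuit choice \<open>bp\<close>.\<close>

definition lass0_01 ::
    "(real \<Rightarrow> real \<Rightarrow> real) \<Rightarrow> (real ^ 'n::finite \<Rightarrow> real ^ 'p::finite) \<Rightarrow> real \<Rightarrow> real ^ 'n \<Rightarrow> real ^ 'p" where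
  "lass0_01 \<eta> bp \<tau> y = (\<chi> j. \<eta> \<tau> (bp y $ j))"

definition support :: "real ^ 'p::finite \<Rightarrow> 'p set" where
  "support \<beta> = {j. \<beta> $ j \<noteq> 0}"

definition min_abs :: "real ^ 'p::finite \<Rightarrow> ereal" where
  "min_abs \<beta> = (if support \<beta> = {} then \<infinity> else ereal (Min ((\<lambda>j. \<bar>\<beta> $ j\<bar>) ` support \<beta>)))"

definition stable_null_space_property ::
    "real ^ 'p::finite ^ 'n::finite \<Rightarrow> real \<Rightarrow> 'p set \<Rightarrow> bool" where
  "stable_null_space_property X \<rho> S \<longleftrightarrow>
     (\<forall>\<beta>. X *v \<beta> = 0 \<longrightarrow> l1_on S \<beta> \<le> \<rho> * l1_on (- S) \<beta>)"

end

theory Submission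
  imports Defs
begin

text \<open>Let \<open>e = bp \<epsilon>\<close> and \<open>h = bp y - \<beta>0 - e\<close>, a vector in the kernel of \<open>X\<close>. As \<open>\<beta>0 + e\<close> is
  feasible for \<open>y\<close>, minimality of \<open>bp y\<close> bounds the mass of \<open>h\<close> off the support \<open>S\<close> of \<open>\<beta>0\<close> by
  its mass on \<open>S\<close> plus \<open>2 \<parallel>e\<parallel>\<^sub>1\<close>. The null space property turns this into
  \<open>\<parallel>bp y - \<beta>0\<parallel>\<^sub>1 \<le> K = (3 + \<rho>) / (1 - \<rho>) \<parallel>e\<parallel>\<^sub>1\<close>. All nonzero entries of \<open>\<beta>0\<close> exceed \<open>2 K\<close>
  in absolute value, so half of a lower bound for them is a suitable threshold.\<close>

lemma l1_on_nonneg: "0 \<le> l1_on S \<beta>"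
  by (simp add: l1_on_def sum_nonneg)

lemma l1_on_triangle: "l1_on S (\<beta> + \<gamma>) \<le> l1_on S \<beta> + l1_on S \<gamma>"
  by (simp add: l1_on_def sum.distrib [symmetric] sum_mono)

lemma l1_on_minus: "l1_on S (- \<beta>) = l1_on S \<beta>"
  by (simp add: l1_on_def)

lemma l1_norm_split: "l1_norm \<beta> = l1_on S \<beta> + l1_on (- S) \<beta>"
  using sum.subset_diff[of S UNIV "\<lambda>j. \<bar>\<beta> $ j\<bar>"]
  by (simp add: l1_on_def Compl_eq_Diff_UNIV)

lemma component_le_l1_norm: "\<bar>\<beta> $ j\<bar> \<le> l1_norm \<beta>"
  unfolding l1_on_def by (rule member_le_sum) auto

lemma basis_pursuit_error:
  assumes bp: "basis_pursuit_solution X (X *v (\<beta>0 + e)) b"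
    and nsp: "stable_null_space_property X \<rho> (support \<beta>0)"
    and \<rho>: "0 < \<rho>" "\<rho> < 1"
  shows "l1_norm (b - \<beta>0) \<le> (3 + \<rho>) / (1 - \<rho>) * l1_norm e"
proof -
  define S h where "S = support \<beta>0" and "h = b - \<beta>0 - e"
  have Xb: "X *v (\<beta>0 + e) = X *v b" and min: "l1_norm b \<le> l1_norm (\<beta>0 + e)"
    using bp by (force simp: basis_pursuit_solution_def is_arg_min_linorder)+
  from Xb have "X *v h = 0"
    by (simp add: h_def matrix_vector_mult_diff_distrib matrix_vector_right_distrib
        diff_diff_eq)
  with nsp have cone: "l1_on S h \<le> \<rho> * l1_on (- S) h"
    by (simp add: stable_null_space_property_def S_def)
  have off: "l1_on (- S) \<beta>0 = 0" "l1_on (- S) (\<beta>0 + h) = l1_on (- S) h"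
    by (auto simp: l1_on_def S_def support_def intro!: sum.cong)
  \<comment> \<open>On \<open>S\<close> the vector \<open>h\<close> can cancel at most its own mass
    of \<open>\<beta>0\<close>; off \<open>S\<close> nothing cancels, since \<open>\<beta>0\<close>
    vanishes there.\<close>
  have "l1_on S \<beta>0 \<le> l1_on S (\<beta>0 + h) + l1_on S h"
    using l1_on_triangle[of S "\<beta>0 + h" "- h"] by (simp add: l1_on_minus)
  moreover have "l1_norm (\<beta>0 + h) \<le> l1_norm b + l1_norm e"
    using l1_on_triangle[of UNIV b "- e"] by (simp add: l1_on_minus h_def)
  \<comment> \<open>\<open>\<beta>0 + h = b - e\<close> and minimality of \<open>b\<close> each cost
    one \<open>l1_norm e\<close>: \<open>l1_norm (\<beta>0 + h)\<close> is at most
    \<open>l1_norm \<beta>0 + 2 * l1_norm e\<close>. Splitting both norms along \<open>S\<close>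
    cancels \<open>l1_on S \<beta>0\<close>.\<close>
  ultimately have "l1_on (- S) h \<le> l1_on S h + 2 * l1_norm e"
    using min l1_on_triangle[of UNIV \<beta>0 e] off
      l1_norm_split[of \<beta>0 S] l1_norm_split[of "\<beta>0 + h" S] by linarith
  with cone have "(1 - \<rho>) * l1_on (- S) h \<le> 2 * l1_norm e"
    by (simp add: algebra_simps)
  with \<rho> have off_h: "l1_on (- S) h \<le> 2 * l1_norm e / (1 - \<rho>)"
    by (simp add: field_simps)
  have "l1_norm (b - \<beta>0) \<le> l1_norm h + l1_norm e"
    using l1_on_triangle[of UNIV h e] by (simp add: h_def)
  also have "\<dots> \<le> (1 + \<rho>) * l1_on (- S) h + l1_norm e"
    using cone l1_norm_split[of h S] by (simp add: algebra_simps)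
  also have "\<dots> \<le> (1 + \<rho>) * (2 * l1_norm e / (1 - \<rho>)) + l1_norm e"
    using off_h \<rho> by (intro add_right_mono mult_left_mono) auto
  \<comment> \<open>The numerator is \<open>2 * (1 + \<rho>) + (1 - \<rho>)\<close>.\<close>
  also have "\<dots> = (3 + \<rho>) / (1 - \<rho>) * l1_norm e"
    using \<rho> by (simp add: field_simps)
  finally show ?thesis .
qed

text \<open>For \<open>t = 0\<close> the value \<open>x\<close> is thresholded to 0. Otherwise the
  factor 2 keeps \<open>x\<close> farther than \<open>\<tau>\<close> from 0, on the same side as
  \<open>t\<close>.\<close>

lemma sgn_thresholding:
  assumes "thresholding \<tau> f" and close: "\<bar>x - t\<bar> < \<tau>"
    and large: "t \<noteq> 0 \<Longrightarrow> 2 * \<tau> \<le> \<bar>t\<bar>"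
  shows "sgn (f x) = sgn t"
proof (cases "t = 0")
  case True
  with assms show ?thesis by (auto simp: thresholding_def)
next
  case False
  with close large have "\<not> \<bar>x\<bar> \<le> \<tau>" and "sgn x = sgn t"
    by (auto simp: sgn_real_def)
  with assms(1) show ?thesis by (simp add: thresholding_def)
qed

text \<open>Trades a possibly infinite minimum for a real number that can be halved; with empty
  support any \<open>m\<close> above \<open>c\<close> serves.\<close>

lemma less_min_abs_imp_lower_bound:
  assumes "ereal c < min_abs \<beta>"
  obtains m where "c < m" and "\<And>j. \<beta> $ j \<noteq> 0 \<Longrightarrow> m \<le> \<bar>\<beta> $ j\<bar>"
proof (cases "support \<beta> = {}")
  case True
  then show thesis using that[of "c + 1"] by (auto simp: support_def)
next
  case False
  then show thesis
    using assms
    by (intro that[of "Min ((\<lambda>j. \<bar>\<beta> $ j\<bar>) ` support \<beta>)"] Min_le)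
      (simp_all add: min_abs_def, simp add: support_def)
qed

theorem theorem1:
  fixes X :: "real ^ 'p::finite ^ 'n::finite"
    and \<beta>0 :: "real ^ 'p"
    and \<epsilon> y :: "real ^ 'n"
    and bp :: "real ^ 'n \<Rightarrow> real ^ 'p"
    and \<eta> :: "real \<Rightarrow> real \<Rightarrow> real"
    and \<rho> :: real
  assumes "y = X *v \<beta>0 + \<epsilon>"
    and "basis_pursuit_choice X bp"
    and "\<And>\<tau>. \<tau> \<ge> 0 \<Longrightarrow> thresholding \<tau> (\<eta> \<tau>)"
    and "rank X = CARD('n)"
    and "0 < \<rho>" and "\<rho> < 1"
    and "stable_null_space_property X \<rho> (support \<beta>0)"
    and "min_abs \<beta>0 > ereal (2 * (3 + \<rho>) / (1 - \<rho>) * l1_norm (bp \<epsilon>))"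
  shows "\<exists>\<tau>>0. \<forall>j. sgn (lass0_01 \<eta> bp \<tau> y $ j) = sgn (\<beta>0 $ j)"
proof -
  define K where "K = (3 + \<rho>) / (1 - \<rho>) * l1_norm (bp \<epsilon>)"
  \<comment> \<open>Full row rank makes every right-hand side feasible, so \<open>bp\<close> returns
    genuine minimizers at both \<open>\<epsilon>\<close> and \<open>y\<close>.\<close>
  have "surj ((*v) X)"
    using assms(4) by (simp add: full_rank_surjective)
  then have sol: "basis_pursuit_solution X v (bp v)" for v
    using assms(2) unfolding basis_pursuit_choice_def by (metis surjD)
  have "\<epsilon> = X *v bp \<epsilon>"
    using sol[of \<epsilon>] by (simp add: basis_pursuit_solution_def is_arg_min_def)
  with assms(1) have "y = X *v (\<beta>0 + bp \<epsilon>)"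
    by (simp add: matrix_vector_right_distrib)
  with sol[of y] have "l1_norm (bp y - \<beta>0) \<le> K"
    unfolding K_def using assms(5-7) by (intro basis_pursuit_error) simp_all
  then have err: "\<bar>bp y $ j - \<beta>0 $ j\<bar> \<le> K" for j
    using component_le_l1_norm[of "bp y - \<beta>0" j] by simp
  have "2 * K = 2 * (3 + \<rho>) / (1 - \<rho>) * l1_norm (bp \<epsilon>)"
    by (simp add: K_def algebra_simps)
  then have "ereal (2 * K) < min_abs \<beta>0"
    using assms(8) by (simp only:)
  then obtain m where m: "2 * K < m" "\<And>j. \<beta>0 $ j \<noteq> 0 \<Longrightarrow> m \<le> \<bar>\<beta>0 $ j\<bar>"
    by (rule less_min_abs_imp_lower_bound) blast
  \<comment> \<open>Since \<open>m\<close> lies strictly above \<open>2 * K\<close>, the threshold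
    is positive even if \<open>K = 0\<close>.\<close>
  have "K \<ge> 0"
    using assms(5,6) by (simp add: K_def l1_on_nonneg)
  with m(1) have pos: "m / 2 > 0" by simp
  have "sgn (\<eta> (m / 2) (bp y $ j)) = sgn (\<beta>0 $ j)" for j
  proof (rule sgn_thresholding[of "m / 2" "\<eta> (m / 2)"])
    show "thresholding (m / 2) (\<eta> (m / 2))" using assms(3) pos by simp
    show "\<bar>bp y $ j - \<beta>0 $ j\<bar> < m / 2" using err[of j] m(1) by simp
    show "2 * (m / 2) \<le> \<bar>\<beta>0 $ j\<bar>" if "\<beta>0 $ j \<noteq> 0" using m(2) that by simp
  qed
  with pos show ?thesis
    by (intro exI[of _ "m / 2"]) (simp add: lass0_01_def)
qed

end
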